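(* Let $\Delta$ be the root system of a Lie algebra $\mathfrak g$ of finite or affine type, with simple roots $\{\alpha_i \mid i\in\mathcal I\}$, and fix a nonempty subset $I\subseteq\mathcal I$. Suppose $\beta\in\Delta^+$ is a positive root with $m=\mathrm{ht}_I(\beta)>0$. Then there exist roots $\gamma_1,\ldots,\gamma_m\in\Delta_{I,1}$ such that $$\beta=\sum_{j=1}^m\gamma_j\qquad\text{and}\qquad \sum_{j=1}^i\gamma_j\in\Delta^+\quad\text{for all }1\le i\le m.$$
   Context: $\mathfrak g=\mathfrak g(A)$ is either a complex finite-dimensional simple Lie algebra ("finite type") or a complex affine Kac--Moody Lie algebra ("affine type"), with Cartan matrix $A$ and a fixed Cartan subalgebra $\mathfrak h$. $\Delta\subset\mathfrak h^*$ is its root system (all roots, real and imaginary), $\Pi=\{\alpha_i\mid i\in\mathcal I\}$ the simple roots, indexed by the set $\mathcal I$ of nodes of the Dynkin diagram, and $\Delta^+$ the set of positive roots. For $x=\sum_{i\in\mathcal I}c_i\alpha_i$ with $c_i\in\mathbb C$, and $I\subseteq\mathcal I$, put $\mathrm{ht}_I(x):=\sum_{i\in I}c_i$. For $\emptyset\ne I\subseteq\mathcal I$, put $\Delta_{I,1}:=\{\beta\in\Delta\mid \mathrm{ht}_I(\beta)=1\}\subseteq\Delta^+$. *)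

theory Defs
  imports "HOL-Analysis.Analysis" "HOL-Library.Function_Algebras"
begin

text \<open>
  A complex Lie algebra is a complex vector space (in the sense of the library locale
  \<open>vector_space\<close>, so the whole type \<open>'g\<close> is the space) with a bilinear, alternating bracket
  satisfying the Jacobi identity.
\<close>

locale lie_algebra = vector_space scale
  for scale :: "complex \<Rightarrow> 'g::ab_group_add \<Rightarrow> 'g"
  and bracket :: "'g \<Rightarrow> 'g \<Rightarrow> 'g" +
  assumes bracket_add_left: "bracket (x + y) z = bracket x z + bracket y z"
    and bracket_add_right: "bracket x (y + z) = bracket x y + bracket x z"
    and bracket_scale_left: "bracket (scale c x) y = scale c (bracket x y)"
    and bracket_scale_right: "bracket x (scale c y) = scale c (bracket x y)"
    and bracket_self: "bracket x x = 0"
    and jacobi: "bracket x (bracket y z) + bracket y (bracket z x) + bracket z (bracket x y) = 0"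
begin

definition lie_subalgebra :: "'g set \<Rightarrow> bool" where
  "lie_subalgebra S \<longleftrightarrow> subspace S \<and> (\<forall>x\<in>S. \<forall>y\<in>S. bracket x y \<in> S)"

definition lie_ideal :: "'g set \<Rightarrow> bool" where
  "lie_ideal J \<longleftrightarrow> subspace J \<and> (\<forall>x. \<forall>y\<in>J. bracket x y \<in> J)"

definition simple_lie_algebra :: bool where
  "simple_lie_algebra \<longleftrightarrow>
     (\<exists>x y. bracket x y \<noteq> 0) \<and> (\<forall>J. lie_ideal J \<longrightarrow> J = {0} \<or> J = UNIV)"

definition finite_dimensional :: bool where
  "finite_dimensional \<longleftrightarrow> (\<exists>B. finite B \<and> span B = UNIV)"

text \<open>
  The dual space of a subspace \<open>H\<close>.  A functional on \<open>H\<close> is represented by its extension by zero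
  to all of \<open>'g\<close>, so that equality, addition and being zero in the dual space are equality,
  pointwise addition and being zero of functions.
\<close>

definition dual_space :: "'g set \<Rightarrow> ('g \<Rightarrow> complex) set" where
  "dual_space H = {\<phi>. (\<forall>x\<in>H. \<forall>y\<in>H. \<phi> (x + y) = \<phi> x + \<phi> y) \<and>
                      (\<forall>c. \<forall>x\<in>H. \<phi> (scale c x) = c * \<phi> x) \<and>
                      (\<forall>x. x \<notin> H \<longrightarrow> \<phi> x = 0)}"

definition root_space :: "'g set \<Rightarrow> ('g \<Rightarrow> complex) \<Rightarrow> 'g set" where
  "root_space H \<phi> = {x. \<forall>h\<in>H. bracket h x = scale (\<phi> h) x}"

definition roots :: "'g set \<Rightarrow> ('g \<Rightarrow> complex) set" where
  "roots H = {\<phi> \<in> dual_space H. \<phi> \<noteq> 0 \<and> root_space H \<phi> \<noteq> {0}}"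

end

definition generalized_cartan_matrix :: "int^'i^'i \<Rightarrow> bool" where
  "generalized_cartan_matrix A \<longleftrightarrow>
     (\<forall>i. A $ i $ i = 2) \<and>
     (\<forall>i j. i \<noteq> j \<longrightarrow> A $ i $ j \<le> 0) \<and>
     (\<forall>i j. A $ i $ j = 0 \<longleftrightarrow> A $ j $ i = 0)"

definition indecomposable_matrix :: "int^'i^'i \<Rightarrow> bool" where
  "indecomposable_matrix A \<longleftrightarrow>
     (\<nexists>J. J \<noteq> {} \<and> J \<noteq> UNIV \<and> (\<forall>i\<in>J. \<forall>j\<in>- J. A $ i $ j = 0 \<and> A $ j $ i = 0))"

text \<open>
  Class (Aff) in the Fin/Aff/Ind trichotomy of indecomposable generalized Cartan matrices
  (V. Kac, Infinite dimensional Lie algebras, Theorem 4.3).  Twisted types are included.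
\<close>

definition affine_type :: "int^'i^'i \<Rightarrow> bool" where
  "affine_type A \<longleftrightarrow>
     generalized_cartan_matrix A \<and> indecomposable_matrix A \<and>
     rank (map_matrix real_of_int A) + 1 = CARD('i) \<and>
     (\<exists>u. (\<forall>i. u $ i > 0) \<and> map_matrix real_of_int A *v u = 0) \<and>
     (\<forall>v. (\<forall>i. (map_matrix real_of_int A *v v) $ i \<ge> 0) \<longrightarrow> map_matrix real_of_int A *v v = 0)"

definition lin_comb :: "('i::finite \<Rightarrow> 'g \<Rightarrow> complex) \<Rightarrow> ('i \<Rightarrow> complex) \<Rightarrow> 'g \<Rightarrow> complex" where
  "lin_comb sroot c = (\<lambda>h. \<Sum>i\<in>UNIV. c i * sroot i h)"

text \<open>
  The locale says that the Lie algebra is \<open>\<gg>(A)\<close>, with Cartan subalgebra \<open>H\<close>, simple coroots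
  \<open>coroot i\<close>, simple roots \<open>sroot i\<close> and Chevalley generators \<open>e i\<close>, \<open>f i\<close>: the triple
  \<open>(H, sroot, coroot)\<close> is a realization of \<open>A\<close>, the algebra is generated by \<open>H\<close> and the
  \<open>e i\<close>, \<open>f i\<close> subject to the relations of the auxiliary algebra with the same generators, and
  the maximal ideal intersecting \<open>H\<close> trivially has been divided out, i.e. no nonzero ideal
  intersects \<open>H\<close> trivially (Kac, sections 1.1--1.3 and Proposition 1.4).
  Convention: \<open>sroot j (coroot i) = A $ i $ j\<close>.
\<close>

locale kac_moody_algebra = lie_algebra scale bracket
  for scale :: "complex \<Rightarrow> 'g::ab_group_add \<Rightarrow> 'g"
  and bracket :: "'g \<Rightarrow> 'g \<Rightarrow> 'g"
  and A :: "int^'i::finite^'i"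
  and H :: "'g set"
  and coroot :: "'i \<Rightarrow> 'g"
  and sroot :: "'i \<Rightarrow> 'g \<Rightarrow> complex"
  and e f :: "'i \<Rightarrow> 'g" +
  assumes gcm: "generalized_cartan_matrix A"
    and H_subspace: "subspace H"
    and H_finite_dimensional: "\<exists>B. finite B \<and> span B = H"
    and H_dim: "dim H + rank (map_matrix complex_of_int A) = 2 * CARD('i)"
    and coroot_in_H: "coroot i \<in> H"
    and sroot_in_dual: "sroot i \<in> dual_space H"
    and coroot_independent: "(\<Sum>i\<in>UNIV. scale (c i) (coroot i)) = 0 \<Longrightarrow> c i = 0"
    and sroot_independent: "lin_comb sroot c = 0 \<Longrightarrow> c i = 0"
    and sroot_coroot: "sroot j (coroot i) = of_int (A $ i $ j)"
    and bracket_H_H: "h \<in> H \<Longrightarrow> h' \<in> H \<Longrightarrow> bracket h h' = 0"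
    and bracket_H_e: "h \<in> H \<Longrightarrow> bracket h (e i) = scale (sroot i h) (e i)"
    and bracket_H_f: "h \<in> H \<Longrightarrow> bracket h (f i) = scale (- sroot i h) (f i)"
    and bracket_e_f: "bracket (e i) (f j) = (if i = j then coroot i else 0)"
    and generated: "lie_subalgebra hull (H \<union> range e \<union> range f) = UNIV"
    and no_ideal: "lie_ideal J \<Longrightarrow> J \<inter> H = {0} \<Longrightarrow> J = {0}"
begin

definition finite_or_affine :: bool where
  "finite_or_affine \<longleftrightarrow> finite_dimensional \<and> simple_lie_algebra \<or> affine_type A"

definition pos_roots :: "('g \<Rightarrow> complex) set" where
  "pos_roots = {\<beta> \<in> roots H. \<exists>n :: 'i \<Rightarrow> nat. \<beta> = lin_comb sroot (\<lambda>i. of_nat (n i))}"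

text \<open>
  The coefficients are unique by linear independence of the simple roots.  The value is only
  meaningful for \<open>x\<close> in the span of the simple roots, which contains all roots.
\<close>

definition ht :: "'i set \<Rightarrow> ('g \<Rightarrow> complex) \<Rightarrow> complex" where
  "ht I x = (\<Sum>i\<in>I. (THE c. x = lin_comb sroot c) i)"

definition roots_ht_1 :: "'i set \<Rightarrow> ('g \<Rightarrow> complex) set" where
  "roots_ht_1 I = {\<beta> \<in> roots H. ht I \<beta> = 1}"

end

end

theory Submission
  imports Defs
begin

text \<open>
  By the triangular decomposition, a positive root is the degree of a nonzero right-normed monomial
  \<open>[e i1, [e i2, \<dots>]]\<close>.  A monomial of \<open>I\<close>-height \<open>m \<ge> 2\<close> is a combination of brackets \<open>[a, b]\<close>
  of monomials of \<open>I\<close>-heights \<open>1\<close> and \<open>m - 1\<close>: if its outermost letter \<open>e i\<close> has \<open>i \<in> I\<close> this is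
  immediate, and otherwise the Jacobi identity distributes \<open>e i\<close> over such a combination for the
  shorter monomial.  As some \<open>[a, b]\<close> is nonzero, a positive root of \<open>I\<close>-height \<open>m\<close> is the sum
  of a positive root of \<open>I\<close>-height \<open>m - 1\<close> and one of \<open>I\<close>-height \<open>1\<close>.
\<close>

lemma sum_fun_upd_Suc:
  assumes "finite I"
  shows "(\<Sum>j\<in>I. (n(i := Suc (n i))) j) = (\<Sum>j\<in>I. n j) + (if i \<in> I then 1 else 0)"
proof -
  have "(n(i := Suc (n i))) j = n j + (if j = i then 1 else 0)" for j by simp
  then show ?thesis using assms by (simp only: sum.distrib) simp
qed

section \<open>Bracket identities and spanning sets stable under generators\<close>

context lie_algebra
begin

lemma bracket_zero_left [simp]: "bracket 0 x = 0"
  using bracket_add_left[of 0 0 x] by simp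

lemma bracket_zero_right [simp]: "bracket x 0 = 0"
  using bracket_add_right[of x 0 0] by simp

lemma bracket_antisym: "bracket x y = - bracket y x"
  using bracket_self[of "x + y"]
  unfolding bracket_add_left bracket_add_right
  by (simp add: bracket_self[of x] bracket_self[of y] eq_neg_iff_add_eq_0 add.commute)

lemma bracket_minus_right: "bracket x (- y) = - bracket x y"
  using bracket_add_right[of x y "- y"] by (simp add: minus_unique)

text \<open>The Jacobi identity in derivation form: later arguments use it to push a bracket through
  a nested one.\<close>

lemma jacobi_derivation:
  "bracket x (bracket y z) = bracket (bracket x y) z + bracket y (bracket x z)"
proof -
  have "bracket y (bracket z x) = - bracket y (bracket x z)"
    by (metis bracket_antisym bracket_minus_right)
  moreover have "bracket z (bracket x y) = - bracket (bracket x y) z"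
    by (rule bracket_antisym)
  ultimately show ?thesis
    using jacobi[of x y z] by (simp add: algebra_simps add_eq_0_iff)
qed

lemma bracket_sum_right: "bracket x (sum v F) = (\<Sum>k\<in>F. bracket x (v k))"
  by (induction F rule: infinite_finite_induct) (simp_all add: bracket_add_right)

lemma bracket_span_right:
  assumes "y \<in> span S" and "\<And>s. s \<in> S \<Longrightarrow> bracket x s \<in> span R"
  shows "bracket x y \<in> span R"
  using assms(1)
proof (induction rule: span_induct_alt)
  case base
  show ?case by (simp add: span_zero)
next
  case (step c s y)
  then show ?case
    by (simp add: assms(2) bracket_add_right bracket_scale_right span_add span_scale)
qed

text \<open>The elements that map \<open>span S\<close> into itself form a subalgebra
  \<open>N\<close>, by the derivation rule. It contains the generating set \<open>G\<close>, so it
  is everything; thus \<open>span S\<close> is an ideal. As a subalgebra containing \<open>G\<close>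
  it is then the whole algebra.\<close>

lemma generated_ideal_UNIV:
  assumes "lie_subalgebra hull G = UNIV" and "G \<subseteq> span S"
    and ad: "\<And>g s. g \<in> G \<Longrightarrow> s \<in> S \<Longrightarrow> bracket g s \<in> span S"
  shows "span S = UNIV"
proof -
  define N where "N = {x. \<forall>y\<in>span S. bracket x y \<in> span S}"
  have "subspace N"
    unfolding subspace_def N_def
    by (simp add: span_zero bracket_add_left bracket_scale_left span_add span_scale)
  moreover have "bracket x y \<in> N" if "x \<in> N" "y \<in> N" for x y
  proof -
    have "bracket (bracket x y) z = bracket x (bracket y z) - bracket y (bracket x z)" for z
      using jacobi_derivation[of x y z] by simp
    then show ?thesis using that by (simp add: N_def span_diff)
  qed
  ultimately have "lie_subalgebra N" by (simp add: lie_subalgebra_def)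
  moreover have "G \<subseteq> N" by (auto simp: N_def intro: bracket_span_right ad)
  ultimately have "N = UNIV" using assms(1) hull_minimal[of G N] by blast
  then have "lie_subalgebra (span S)"
    by (auto simp: lie_subalgebra_def N_def)
  then show ?thesis using assms(1,2) hull_minimal[of G "span S"] by blast
qed

section \<open>Root spaces: brackets and linear independence\<close>

lemma root_space_bracket:
  assumes "x \<in> root_space H \<phi>" "y \<in> root_space H \<psi>"
  shows "bracket x y \<in> root_space H (\<phi> + \<psi>)"
proof -
  have "bracket h (bracket x y) = scale ((\<phi> + \<psi>) h) (bracket x y)" if "h \<in> H" for h
    using that assms unfolding jacobi_derivation[of h x y]
    by (simp add: root_space_def bracket_scale_left bracket_scale_right scale_left_distrib)
  then show ?thesis by (simp add: root_space_def)
qed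

lemma subspace_root_space: "subspace (root_space H \<phi>)"
  by (auto simp: subspace_def root_space_def bracket_add_right bracket_scale_right
      scale_right_distrib mult.commute)

text \<open>The classical argument for simultaneous eigenvectors. If \<open>h\<close> separates
  \<phi> from \<psi>, then \<open>bracket h\<close> minus the scalar \<open>\<psi> h\<close> kills
  the \<psi>-component and multiplies the \<phi>-component by a nonzero scalar, leaving a relation
  over the smaller set \<open>F\<close>.\<close>

lemma root_spaces_independent:
  assumes "finite F" "F \<subseteq> dual_space H" "\<And>\<phi>. \<phi> \<in> F \<Longrightarrow> v \<phi> \<in> root_space H \<phi>"
    and "(\<Sum>\<phi>\<in>F. v \<phi>) = 0"
  shows "\<forall>\<phi>\<in>F. v \<phi> = 0"
  using assms
proof (induction F arbitrary: v)
  case empty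
  then show ?case by simp
next
  case (insert \<psi> F)
  have F: "v \<phi> = 0" if "\<phi> \<in> F" for \<phi>
  proof -
    have "\<phi> \<noteq> \<psi>" "\<phi> \<in> dual_space H" "\<psi> \<in> dual_space H"
      using that insert by auto
    moreover have "\<phi> h = \<psi> h" if "h \<notin> H" for h
      using that \<open>\<phi> \<in> dual_space H\<close> \<open>\<psi> \<in> dual_space H\<close> by (simp add: dual_space_def)
    \<comment> \<open>Elements of \<open>dual_space H\<close> vanish outside \<open>H\<close>, so
      two distinct ones already differ at a point of \<open>H\<close>.\<close>
    ultimately obtain h where h: "h \<in> H" "\<phi> h \<noteq> \<psi> h" by blast
    define w where "w \<phi> = scale (\<phi> h - \<psi> h) (v \<phi>)" for \<phi>
    have bv: "bracket h (v \<phi>) = scale (\<phi> h) (v \<phi>)" if "\<phi> \<in> insert \<psi> F" for \<phi>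
      using insert.prems(2)[OF that] h(1) by (simp add: root_space_def)
    have "(\<Sum>\<phi>\<in>F. w \<phi>) = (\<Sum>\<phi>\<in>insert \<psi> F. w \<phi>)"
      using insert.hyps by (simp add: w_def)
    also have "\<dots> = (\<Sum>\<phi>\<in>insert \<psi> F. bracket h (v \<phi>) - scale (\<psi> h) (v \<phi>))"
      by (rule sum.cong) (simp_all add: bv w_def scale_left_diff_distrib)
    also have "\<dots> = bracket h (\<Sum>\<phi>\<in>insert \<psi> F. v \<phi>) - scale (\<psi> h) (\<Sum>\<phi>\<in>insert \<psi> F. v \<phi>)"
      by (simp only: sum_subtractf bracket_sum_right scale_sum_right)
    also have "\<dots> = 0"
      using insert.prems(3) by simp
    finally have "(\<Sum>\<phi>\<in>F. w \<phi>) = 0" .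
    moreover have "w \<phi> \<in> root_space H \<phi>" if "\<phi> \<in> F" for \<phi>
      using insert.prems(2) that by (simp add: w_def subspace_scale[OF subspace_root_space])
    ultimately have "w \<phi> = 0"
      using insert.IH[of w] insert.prems(1) that by auto
    then show ?thesis using h(2) by (simp add: w_def)
  qed
  then have "v \<psi> = 0" using insert by simp
  with F show ?case by simp
qed

lemma span_root_spaces_sum:
  assumes "x \<in> span (\<Union>\<phi>\<in>\<Phi>. root_space H \<phi>)"
  shows "\<exists>F v. finite F \<and> F \<subseteq> \<Phi> \<and> (\<forall>\<phi>. v \<phi> \<in> root_space H \<phi>) \<and> x = (\<Sum>\<phi>\<in>F. v \<phi>)"
  using assms
proof (induction rule: span_induct_alt)
  case base
  show ?case
    by (rule exI[of _ "{}"], rule exI[of _ "\<lambda>_. 0"])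
      (simp add: subspace_0[OF subspace_root_space])
next
  case (step c s y)
  then obtain F v \<psi> where F: "finite F" "F \<subseteq> \<Phi>" "\<forall>\<phi>. v \<phi> \<in> root_space H \<phi>"
      "y = (\<Sum>\<phi>\<in>F. v \<phi>)" and s: "\<psi> \<in> \<Phi>" "s \<in> root_space H \<psi>"
    by blast
  \<comment> \<open>The weight \<psi> may already occur in \<open>F\<close>, so the new term is
    added to the component there. Outside \<open>F\<close> the old \<open>v\<close> is reset to 0,
    since it is not controlled there.\<close>
  define v' where "v' \<phi> = (if \<phi> \<in> F then v \<phi> else 0) + (if \<phi> = \<psi> then scale c s else 0)" for \<phi>
  have "(\<Sum>\<phi>\<in>insert \<psi> F. v' \<phi>)
      = (\<Sum>\<phi>\<in>insert \<psi> F. if \<phi> \<in> F then v \<phi> else 0) + (\<Sum>\<phi>\<in>insert \<psi> F. if \<phi> = \<psi> then scale c s else 0)"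
    by (simp only: v'_def sum.distrib)
  also have "(\<Sum>\<phi>\<in>insert \<psi> F. if \<phi> \<in> F then v \<phi> else 0) = (\<Sum>\<phi>\<in>F. v \<phi>)"
    by (rule sum.mono_neutral_cong_right) (use F(1) in auto)
  also have "(\<Sum>\<phi>\<in>insert \<psi> F. if \<phi> = \<psi> then scale c s else 0) = scale c s"
    using F(1) by (simp add: sum.delta')
  finally have "scale c s + y = (\<Sum>\<phi>\<in>insert \<psi> F. v' \<phi>)"
    using F(4) by (simp add: add.commute)
  moreover have "\<forall>\<phi>. v' \<phi> \<in> root_space H \<phi>"
    using F(3) s by (auto simp: v'_def subspace_add[OF subspace_root_space]
        subspace_scale[OF subspace_root_space] subspace_0[OF subspace_root_space])
  ultimately show ?case
    using F(1,2) s(1) by (intro exI[of _ "insert \<psi> F"] exI[of _ v']) simp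
qed

lemma root_space_inter_span_others:
  assumes "\<beta> \<in> dual_space H" "\<Phi> \<subseteq> dual_space H" "\<beta> \<notin> \<Phi>"
    and "x \<in> root_space H \<beta>" "x \<in> span (\<Union>\<phi>\<in>\<Phi>. root_space H \<phi>)"
  shows "x = 0"
proof -
  obtain F v where F: "finite F" "F \<subseteq> \<Phi>" "\<forall>\<phi>. v \<phi> \<in> root_space H \<phi>" "x = (\<Sum>\<phi>\<in>F. v \<phi>)"
    using span_root_spaces_sum[OF assms(5)] by blast
  \<comment> \<open>Moving \<open>x\<close> to the other side gives a vanishing sum over
    \<open>insert \<beta> F\<close> with \<beta>-component \<open>- x\<close>.\<close>
  define w where "w = v(\<beta> := - x)"
  have "\<beta> \<notin> F" using F(2) assms(3) by blast
  then have "(\<Sum>\<phi>\<in>F. w \<phi>) = x" using F(4) by (auto simp: w_def intro!: sum.cong)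
  then have "(\<Sum>\<phi>\<in>insert \<beta> F. w \<phi>) = 0"
    using F(1) \<open>\<beta> \<notin> F\<close> by (simp add: w_def)
  moreover have "w \<phi> \<in> root_space H \<phi>" for \<phi>
    using F(3) assms(4) by (simp add: w_def subspace_neg[OF subspace_root_space])
  moreover have "finite (insert \<beta> F)" "insert \<beta> F \<subseteq> dual_space H"
    using F(1,2) assms(1,2) by auto
  ultimately have "w \<beta> = 0"
    using root_spaces_independent[of "insert \<beta> F" H w] by blast
  then show ?thesis by (simp add: w_def)
qed

section \<open>Right-normed monomials with a degree counting each letter, and their splitting by
  \<open>I\<close>-height\<close>

inductive monomial :: "('i \<Rightarrow> 'g) \<Rightarrow> ('i \<Rightarrow> nat) \<Rightarrow> 'g \<Rightarrow> bool" for g where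
  gen: "monomial g (0(i := 1)) (g i)"
| ad: "monomial g n x \<Longrightarrow> monomial g (n(i := Suc (n i))) (bracket (g i) x)"

lemma monomial_degree_nonzero:
  assumes "monomial g n x"
  shows "\<exists>i. n i > 0"
  using assms
  by (cases rule: monomial.cases) (metis fun_upd_same zero_less_one zero_less_Suc)+

lemma monomial_height_split:
  assumes "monomial g n x" "finite I" "(\<Sum>i\<in>I. n i) = Suc (Suc k)"
  shows "x \<in> span {bracket a b |a b. \<exists>p q. monomial g p a \<and> monomial g q b \<and> n = p + q \<and>
    (\<Sum>i\<in>I. p i) = 1 \<and> (\<Sum>i\<in>I. q i) = Suc k}"
  using assms(1,3)
proof (induction rule: monomial.induct)
  \<comment> \<open>A single letter has height at most 1, so this case contradicts the assumed
    height of at least 2.\<close>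
  case (gen i)
  have "(\<Sum>j\<in>I. (0(i := 1)) j) \<le> (1::nat)"
    using assms(2) by (simp add: fun_upd_def zero_fun_def)
  with gen show ?case by simp
next
  case (ad n x i)
  note upd = sum_fun_upd_Suc[OF assms(2)]
  show ?case
  proof (cases "i \<in> I")
    case True
    \<comment> \<open>The outermost letter is itself the factor of height 1, and \<open>x\<close> is
      the other factor.\<close>
    have "n(i := Suc (n i)) = 0(i := 1) + n" by auto
    moreover have "(\<Sum>j\<in>I. (0(i := 1)) j) = (1::nat)"
      using True assms(2) by (simp add: fun_upd_def zero_fun_def)
    moreover have "(\<Sum>j\<in>I. n j) = Suc k" using ad.prems True unfolding upd by simp
    ultimately show ?thesis
      by (intro span_base CollectI exI conjI) (rule refl monomial.gen ad.hyps | assumption)+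
  next
    case False
    have "(\<Sum>j\<in>I. n j) = Suc (Suc k)" using ad.prems False unfolding upd by simp
    from ad.IH[OF this] show ?thesis
    proof (rule bracket_span_right)
      fix s
      assume "s \<in> {bracket a b |a b. \<exists>p q. monomial g p a \<and> monomial g q b \<and> n = p + q \<and>
        (\<Sum>i\<in>I. p i) = 1 \<and> (\<Sum>i\<in>I. q i) = Suc k}"
      then obtain a b p q where s: "s = bracket a b" and m: "monomial g p a" "monomial g q b"
        and n: "n = p + q" and h: "(\<Sum>i\<in>I. p i) = 1" "(\<Sum>i\<in>I. q i) = Suc k"
        by blast
      \<comment> \<open>A letter outside \<open>I\<close> can be absorbed by either factor without
        changing its height, so both terms of the derivation rule have the required shape.\<close>
      let ?p = "p(i := Suc (p i))" and ?q = "q(i := Suc (q i))"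
      have h': "(\<Sum>i\<in>I. ?p i) = 1" "(\<Sum>i\<in>I. ?q i) = Suc k" using h False unfolding upd by simp_all
      have n': "n(i := Suc (n i)) = ?p + q" "n(i := Suc (n i)) = p + ?q" using n by auto
      show "bracket (g i) s \<in> span {bracket a b |a b. \<exists>p q. monomial g p a \<and> monomial g q b \<and>
        n(i := Suc (n i)) = p + q \<and> (\<Sum>i\<in>I. p i) = 1 \<and> (\<Sum>i\<in>I. q i) = Suc k}"
        unfolding s jacobi_derivation[of "g i" a b]
        using monomial.ad[OF m(1), of i] monomial.ad[OF m(2), of i] m h h' n'
        by (intro span_add span_base CollectI) blast+
    qed
  qed
qed

lemma monomial_height_summands:
  assumes "monomial g n x" "x \<noteq> 0" "finite I" "(\<Sum>i\<in>I. n i) = Suc (Suc k)"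
  obtains p q a b where "monomial g p a" "a \<noteq> 0" "monomial g q b" "b \<noteq> 0" "n = p + q"
    "(\<Sum>i\<in>I. p i) = 1" "(\<Sum>i\<in>I. q i) = Suc k"
proof -
  let ?S = "{bracket a b |a b. \<exists>p q. monomial g p a \<and> monomial g q b \<and> n = p + q \<and>
    (\<Sum>i\<in>I. p i) = 1 \<and> (\<Sum>i\<in>I. q i) = Suc k}"
  \<comment> \<open>If all these brackets vanished, so would their span, and with it
    \<open>x\<close>. A nonzero bracket then has nonzero factors.\<close>
  have "\<not> ?S \<subseteq> {0}"
    using monomial_height_split[OF assms(1,3,4)] assms(2) span_mono[of ?S "{0}"] by auto
  then obtain a b p q where *: "bracket a b \<noteq> 0" "monomial g p a" "monomial g q b" "n = p + q"
    "(\<Sum>i\<in>I. p i) = 1" "(\<Sum>i\<in>I. q i) = Suc k"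
    by blast
  then have "a \<noteq> 0" "b \<noteq> 0" by auto
  with * that show thesis by blast
qed

end

section \<open>Combinations of simple roots and weights of monomials\<close>

context kac_moody_algebra
begin

lemma lin_comb_in_dual: "lin_comb sroot c \<in> dual_space H"
  using sroot_in_dual
  by (simp add: dual_space_def lin_comb_def ring_distribs sum.distrib sum_distrib_left mult.left_commute)

lemma lin_comb_add: "lin_comb sroot (c + d) = lin_comb sroot c + lin_comb sroot d"
  by (simp add: lin_comb_def fun_eq_iff ring_distribs sum.distrib)

lemma lin_comb_inj: "lin_comb sroot c = lin_comb sroot d \<longleftrightarrow> c = d"
proof
  assume "lin_comb sroot c = lin_comb sroot d"
  then have "lin_comb sroot (\<lambda>i. c i - d i) = 0"
    by (simp add: lin_comb_def fun_eq_iff algebra_simps sum_subtractf)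
  then show "c = d" using sroot_independent by fastforce
qed simp

text \<open>By \<open>lin_comb_inj\<close> the definite description inside \<open>ht\<close> denotes
  \<open>c\<close>.\<close>

lemma ht_lin_comb: "ht I (lin_comb sroot c) = (\<Sum>i\<in>I. c i)"
  by (simp add: ht_def lin_comb_inj)

lemma lin_comb_single: "lin_comb sroot (\<lambda>j. if j = i then c else 0) = (\<lambda>h. c * sroot i h)"
proof
  fix h
  have "lin_comb sroot (\<lambda>j. if j = i then c else 0) h = (\<Sum>j\<in>UNIV. if j = i then c * sroot j h else 0)"
    unfolding lin_comb_def by (rule sum.cong) auto
  then show "lin_comb sroot (\<lambda>j. if j = i then c else 0) h = c * sroot i h"
    by simp
qed

text \<open>Weights add under brackets. The scalar \<epsilon> lets one induction serve both
  families: it is 1 for \<open>e\<close> and -1 for \<open>f\<close>.\<close>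

lemma monomial_root_space:
  assumes "monomial g n x"
    and g: "\<And>i h. h \<in> H \<Longrightarrow> bracket h (g i) = scale (\<epsilon> * sroot i h) (g i)"
  shows "x \<in> root_space H (lin_comb sroot (\<lambda>i. \<epsilon> * of_nat (n i)))"
proof -
  have g_root_space: "g i \<in> root_space H (lin_comb sroot (\<lambda>j. if j = i then \<epsilon> else 0))" for i
    by (simp add: root_space_def g lin_comb_single)
  show ?thesis
    using assms(1)
  proof (induction rule: monomial.induct)
    case (gen i)
    have "(\<lambda>j. \<epsilon> * of_nat ((0(i := 1)) j)) = (\<lambda>j. if j = i then \<epsilon> else 0)" by auto
    then show ?case using g_root_space[of i] by simp
  next
    case (ad n x i)
    have "(\<lambda>j. \<epsilon> * of_nat ((n(i := Suc (n i))) j))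
        = (\<lambda>j. if j = i then \<epsilon> else 0) + (\<lambda>j. \<epsilon> * of_nat (n j))"
      by (auto simp: algebra_simps)
    then show ?case
      using root_space_bracket[OF g_root_space ad.IH] by (simp only: lin_comb_add)
  qed
qed

lemma e_monomial_root_space:
  "monomial e n x \<Longrightarrow> x \<in> root_space H (lin_comb sroot (\<lambda>i. of_nat (n i)))"
  using monomial_root_space[of e n x 1] bracket_H_e by simp

lemma f_monomial_root_space:
  "monomial f n x \<Longrightarrow> x \<in> root_space H (lin_comb sroot (\<lambda>i. - of_nat (n i)))"
  using monomial_root_space[of f n x "- 1"] bracket_H_f by simp

section \<open>Triangular decomposition\<close>

lemma bracket_generator_monomial:
  assumes "monomial g' n x" and gg': "\<And>i j. bracket (g i) (g' j) \<in> H"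
    and hg': "\<And>i h. h \<in> H \<Longrightarrow> bracket h (g' i) = scale (\<epsilon> * sroot i h) (g' i)"
  shows "bracket (g i) x \<in> span (H \<union> {x. \<exists>n. monomial g' n x})" (is "_ \<in> span ?S")
  using assms(1)
proof (induction rule: monomial.induct)
  case (gen j)
  show ?case using gg' by (simp add: span_base)
next
  case (ad n x j)
  \<comment> \<open>The inner bracket lies in \<open>H\<close>, and \<open>x\<close> is a weight
    vector, so the result is a multiple of \<open>x\<close>.\<close>
  have "bracket (bracket (g i) (g' j)) x \<in> span ?S"
  proof -
    have "x \<in> span ?S" using ad.hyps by (auto intro: span_base)
    then show ?thesis
      using monomial_root_space[OF ad.hyps hg'] gg' by (auto simp: root_space_def intro: span_scale)
  qed
  \<comment> \<open>By induction the inner bracket is a combination of elements of \<open>H\<close>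
    and monomials. Bracketing with \<open>g' j\<close> turns the former into multiples of
    \<open>g' j\<close> and prolongs the latter by one letter.\<close>
  moreover have "bracket (g' j) (bracket (g i) x) \<in> span ?S"
  proof (rule bracket_span_right[OF ad.IH])
    fix s
    assume "s \<in> ?S"
    then show "bracket (g' j) s \<in> span ?S"
    proof
      assume "s \<in> H"
      then have "bracket (g' j) s = scale (- (\<epsilon> * sroot j s)) (g' j)"
        using bracket_antisym[of "g' j" s] hg' by simp
      moreover have "g' j \<in> span ?S" by (auto intro!: span_base monomial.gen)
      ultimately show ?thesis by (simp only: span_scale)
    next
      assume "s \<in> {x. \<exists>n. monomial g' n x}"
      then show ?thesis by (auto intro!: span_base monomial.ad)
    qed
  qed
  ultimately show ?case by (simp add: jacobi_derivation[of "g i" "g' j" x] span_add)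
qed

text \<open>By \<open>generated_ideal_UNIV\<close> it suffices that the span is stable under the
  generators. Elements of \<open>H\<close> act on each spanning vector by a scalar;
  \<open>e i\<close> and \<open>f i\<close> prolong monomials of their own family, send
  \<open>H\<close> to multiples of themselves, and map opposite monomials back by
  \<open>bracket_generator_monomial\<close>.\<close>

lemma triangular_decomposition:
  "span (H \<union> {x. \<exists>n. monomial e n x} \<union> {x. \<exists>n. monomial f n x}) = UNIV" (is "span ?S = UNIV")
proof (rule generated_ideal_UNIV[OF generated])
  show "H \<union> range e \<union> range f \<subseteq> span ?S"
    by (auto intro!: span_base monomial.gen)
  fix g s
  assume gs: "g \<in> H \<union> range e \<union> range f" "s \<in> ?S"
  have mono: "span (H \<union> {x. \<exists>n. monomial e n x}) \<subseteq> span ?S"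
    "span (H \<union> {x. \<exists>n. monomial f n x}) \<subseteq> span ?S"
    by (auto intro!: span_mono)
  have H_s: "bracket h s \<in> span ?S" if "h \<in> H" for h
  proof -
    have "bracket h s = 0 \<or> (\<exists>c. bracket h s = scale c s)"
      using gs(2) that e_monomial_root_space f_monomial_root_space bracket_H_H
      by (fastforce simp: root_space_def)
    then show ?thesis using span_scale[OF span_base[OF gs(2)]] by (auto simp: span_zero)
  qed
  have e_s: "bracket (e i) s \<in> span ?S" for i
    using gs(2)
  proof (elim UnE)
    assume "s \<in> H"
    then have "bracket (e i) s = scale (- sroot i s) (e i)"
      using bracket_antisym[of "e i" s] bracket_H_e by simp
    moreover have "e i \<in> span ?S" by (auto intro!: span_base monomial.gen)
    ultimately show ?thesis by (simp only: span_scale)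
  next
    assume "s \<in> {x. \<exists>n. monomial e n x}"
    then show ?thesis by (auto intro!: span_base monomial.ad)
  next
    assume "s \<in> {x. \<exists>n. monomial f n x}"
    then obtain n where "monomial f n s" by blast
    then have "bracket (e i) s \<in> span (H \<union> {x. \<exists>n. monomial f n x})"
      by (rule bracket_generator_monomial[where \<epsilon> = "- 1"])
        (simp_all add: bracket_H_f bracket_e_f coroot_in_H subspace_0[OF H_subspace])
    then show ?thesis using mono by blast
  qed
  have f_e: "bracket (f i) (e j) = (if i = j then - coroot i else 0)" for i j
    using bracket_antisym[of "f i" "e j"] bracket_e_f by auto
  have f_s: "bracket (f i) s \<in> span ?S" for i
    using gs(2)
  proof (elim UnE)
    assume "s \<in> H"
    then have "bracket (f i) s = scale (sroot i s) (f i)"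
      using bracket_antisym[of "f i" s] bracket_H_f by simp
    moreover have "f i \<in> span ?S" by (auto intro!: span_base monomial.gen)
    ultimately show ?thesis by (simp only: span_scale)
  next
    assume "s \<in> {x. \<exists>n. monomial f n x}"
    then show ?thesis by (auto intro!: span_base monomial.ad)
  next
    assume "s \<in> {x. \<exists>n. monomial e n x}"
    then obtain n where "monomial e n s" by blast
    then have "bracket (f i) s \<in> span (H \<union> {x. \<exists>n. monomial e n x})"
      by (rule bracket_generator_monomial[where \<epsilon> = 1])
        (simp_all add: bracket_H_e f_e coroot_in_H subspace_0[OF H_subspace] subspace_neg[OF H_subspace])
    then show ?thesis using mono by blast
  qed
  show "bracket g s \<in> span ?S" using gs(1) H_s e_s f_s by auto
qed

section \<open>Positive roots as weights of nonzero monomials\<close>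

lemma pos_roots_eq:
  "pos_roots = {lin_comb sroot (\<lambda>i. of_nat (n i)) |n. \<exists>x. monomial e n x \<and> x \<noteq> 0}"
proof (intro equalityI subsetI)
  fix \<beta>
  assume "\<beta> \<in> {lin_comb sroot (\<lambda>i. of_nat (n i)) |n. \<exists>x. monomial e n x \<and> x \<noteq> 0}"
  then obtain n x where \<beta>: "\<beta> = lin_comb sroot (\<lambda>i. of_nat (n i))" and x: "monomial e n x" "x \<noteq> 0"
    by blast
  obtain i where "n i > 0" using monomial_degree_nonzero[OF x(1)] by blast
  \<comment> \<open>Some letter occurs in the monomial, so a coefficient of \<beta> is nonzero and
    independence of the simple roots applies.\<close>
  then have "\<beta> \<noteq> 0" using sroot_independent[of "\<lambda>i. of_nat (n i)" i] \<beta> by auto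
  then show "\<beta> \<in> pos_roots"
    using \<beta> x e_monomial_root_space[OF x(1)] lin_comb_in_dual
    by (auto simp: pos_roots_def roots_def)
next
  fix \<beta>
  assume "\<beta> \<in> pos_roots"
  then obtain n where n: "\<beta> = lin_comb sroot (\<lambda>i. of_nat (n i))" and \<beta>: "\<beta> \<in> roots H"
    by (auto simp: pos_roots_def)
  have "\<beta> \<noteq> 0" using \<beta> by (simp add: roots_def)
  obtain x where x: "x \<in> root_space H \<beta>" "x \<noteq> 0"
    using \<beta> subspace_0[OF subspace_root_space[of H \<beta>]] by (auto simp: roots_def)
  have "\<exists>y. monomial e n y \<and> y \<noteq> 0"
  proof (rule ccontr)
    assume none: "\<not> ?thesis"
    \<comment> \<open>All functionals other than \<beta> are taken, zero and non-roots included.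
      Their root spaces would contain the whole triangular spanning set, hence span everything,
      contradicting independence from the nonzero root vector \<open>x\<close>.\<close>
    let ?\<Phi> = "dual_space H - {\<beta>}"
    let ?U = "\<Union>\<phi>\<in>?\<Phi>. root_space H \<phi>"
    have "0 \<in> dual_space H" by (simp add: dual_space_def)
    moreover have "H \<subseteq> root_space H 0" by (auto simp: root_space_def bracket_H_H)
    ultimately have "H \<subseteq> span ?U" using \<open>\<beta> \<noteq> 0\<close> by (auto intro!: span_base)
    moreover have "y \<in> span ?U" if y: "monomial e k y" for k y
    proof (cases "y = 0")
      case False
      \<comment> \<open>By assumption no nonzero monomial in \<open>e\<close> has degree
        \<open>n\<close>, and different degrees give different weights.\<close>
      then have "k \<noteq> n" using none y by blast
      then have "(\<lambda>i. complex_of_nat (k i)) \<noteq> (\<lambda>i. of_nat (n i))"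
        by (simp add: fun_eq_iff)
      then have "lin_comb sroot (\<lambda>i. of_nat (k i)) \<noteq> \<beta>"
        by (simp add: n lin_comb_inj)
      then show ?thesis
        using e_monomial_root_space[OF y] lin_comb_in_dual by (intro span_base UN_I) auto
    qed (simp add: span_zero)
    moreover have "y \<in> span ?U" if y: "monomial f k y" for k y
    proof -
      \<comment> \<open>A monomial in \<open>f\<close> contains some letter, so its weight has a
        negative coefficient, whereas those of \<beta> are natural numbers.\<close>
      obtain i where i: "k i > 0" using monomial_degree_nonzero[OF y] by blast
      have "- complex_of_nat (k i) \<noteq> of_nat (n i)"
      proof
        assume "- complex_of_nat (k i) = of_nat (n i)"
        then have "complex_of_nat (n i + k i) = 0" by (simp add: eq_neg_iff_add_eq_0 neg_eq_iff_add_eq_0 add.commute)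
        then show False using i by (simp only: of_nat_eq_0_iff)
      qed
      then have "(\<lambda>i. - complex_of_nat (k i)) \<noteq> (\<lambda>i. of_nat (n i))"
        by (auto simp: fun_eq_iff)
      then have "lin_comb sroot (\<lambda>i. - of_nat (k i)) \<noteq> \<beta>"
        by (simp add: n lin_comb_inj)
      then show ?thesis
        using f_monomial_root_space[OF y] lin_comb_in_dual by (intro span_base UN_I) auto
    qed
    ultimately have "H \<union> {x. \<exists>n. monomial e n x} \<union> {x. \<exists>n. monomial f n x} \<subseteq> span ?U"
      by auto
    then have "span ?U = UNIV"
      using triangular_decomposition span_minimal[OF _ subspace_span] by blast
    then have "x = 0"
      using root_space_inter_span_others[of \<beta> H ?\<Phi> x] lin_comb_in_dual n x(1) by auto
    then show False using x(2) by simp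
  qed
  then show "\<beta> \<in> {lin_comb sroot (\<lambda>i. of_nat (n i)) |n. \<exists>x. monomial e n x \<and> x \<noteq> 0}"
    using n by blast
qed

section \<open>Decomposing a positive root by height\<close>

lemma pos_root_height_split:
  assumes "\<beta> \<in> pos_roots" "ht I \<beta> = of_nat (Suc (Suc k))"
  obtains \<gamma> \<delta> where "\<beta> = \<delta> + \<gamma>" "\<gamma> \<in> roots_ht_1 I" "\<delta> \<in> pos_roots" "ht I \<delta> = of_nat (Suc k)"
proof -
  let ?l = "\<lambda>n :: 'i \<Rightarrow> nat. lin_comb sroot (\<lambda>i. of_nat (n i))"
  obtain n x where n: "\<beta> = ?l n" and x: "monomial e n x" "x \<noteq> 0"
    using assms(1) by (auto simp: pos_roots_eq)
  have ht: "ht I (?l n) = of_nat (\<Sum>i\<in>I. n i)" for n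
    by (simp add: ht_lin_comb)
  \<comment> \<open>The complex-valued height is brought back to a count of letters, to which the
    monomial lemmas apply.\<close>
  have ht_n: "(\<Sum>i\<in>I. n i) = Suc (Suc k)"
    using assms(2) unfolding n ht by (simp only: of_nat_eq_iff)
  obtain p q a b where *: "monomial e p a" "a \<noteq> 0" "monomial e q b" "b \<noteq> 0" "n = p + q"
    "(\<Sum>i\<in>I. p i) = 1" "(\<Sum>i\<in>I. q i) = Suc k"
    using monomial_height_summands[OF x finite ht_n] .
  have "\<beta> = ?l q + ?l p"
    by (simp add: n *(5) lin_comb_def fun_eq_iff ring_distribs sum.distrib add.commute)
  moreover have "?l p \<in> pos_roots" "?l q \<in> pos_roots"
    using * by (auto simp: pos_roots_eq)
  moreover have "ht I (?l p) = 1" "ht I (?l q) = of_nat (Suc k)"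
    unfolding ht *(6,7) by simp_all
  ultimately show thesis
    using that by (auto simp: roots_ht_1_def pos_roots_def)
qed

text \<open>Induction on the height, splitting off the last summand: the proper partial sums are
  those of the smaller root \<delta>, and the full sum is \<beta> itself. Writing the height as
  \<open>Suc k\<close> makes height 1 the base case.\<close>

lemma pos_root_partial_sums:
  assumes "\<beta> \<in> pos_roots" "ht I \<beta> = of_nat (Suc k)"
  shows "\<exists>\<gamma>. (\<forall>j\<in>{1..Suc k}. \<gamma> j \<in> roots_ht_1 I) \<and> \<beta> = (\<Sum>j=1..Suc k. \<gamma> j) \<and>
    (\<forall>i\<in>{1..Suc k}. (\<Sum>j=1..i. \<gamma> j) \<in> pos_roots)"
  using assms
proof (induction k arbitrary: \<beta>)
  case 0
  then have "\<beta> \<in> roots_ht_1 I" by (simp add: roots_ht_1_def pos_roots_def)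
  with 0 show ?case by (intro exI[of _ "\<lambda>_. \<beta>"]) simp
next
  case (Suc k)
  obtain \<gamma>' \<delta> where s: "\<beta> = \<delta> + \<gamma>'" "\<gamma>' \<in> roots_ht_1 I" "\<delta> \<in> pos_roots" "ht I \<delta> = of_nat (Suc k)"
    using pos_root_height_split[OF Suc.prems] .
  obtain \<gamma> where \<gamma>: "\<forall>j\<in>{1..Suc k}. \<gamma> j \<in> roots_ht_1 I" "\<delta> = (\<Sum>j=1..Suc k. \<gamma> j)"
    "\<forall>i\<in>{1..Suc k}. (\<Sum>j=1..i. \<gamma> j) \<in> pos_roots"
    using Suc.IH[OF s(3,4)] by blast
  \<comment> \<open>The split-off root takes the new last index, so every sum up to
    \<open>Suc k\<close> is unchanged.\<close>
  define \<eta> where "\<eta> = \<gamma>(Suc (Suc k) := \<gamma>')"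
  have below: "(\<Sum>j=1..i. \<eta> j) = (\<Sum>j=1..i. \<gamma> j)" if "i \<le> Suc k" for i
    using that by (intro sum.cong) (auto simp: \<eta>_def)
  have "\<beta> = (\<Sum>j=1..Suc k. \<eta> j) + \<eta> (Suc (Suc k))"
    unfolding below[OF order_refl] by (simp only: s(1) \<gamma>(2) \<eta>_def fun_upd_same)
  then have total: "\<beta> = (\<Sum>j=1..Suc (Suc k). \<eta> j)"
    by (simp add: add.assoc)
  moreover have "\<forall>j\<in>{1..Suc (Suc k)}. \<eta> j \<in> roots_ht_1 I"
    using \<gamma>(1) s(2) by (auto simp: \<eta>_def le_Suc_eq)
  moreover have "(\<Sum>j=1..i. \<eta> j) \<in> pos_roots" if "i \<in> {1..Suc (Suc k)}" for i
  proof (cases "i = Suc (Suc k)")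
    case True
    show ?thesis unfolding True total[symmetric] by (rule Suc.prems)
  next
    case False
    then have "i \<in> {1..Suc k}" using that by auto
    then show ?thesis using \<gamma>(3) below[of i] by simp
  qed
  ultimately show ?case by blast
qed

end

theorem theorem2p1:
  fixes scale :: "complex \<Rightarrow> 'g::ab_group_add \<Rightarrow> 'g"
    and bracket :: "'g \<Rightarrow> 'g \<Rightarrow> 'g"
    and A :: "int^'i::finite^'i"
    and H :: "'g set"
    and coroot :: "'i \<Rightarrow> 'g"
    and sroot :: "'i \<Rightarrow> 'g \<Rightarrow> complex"
    and e f :: "'i \<Rightarrow> 'g"
    and I :: "'i set"
    and \<beta> :: "'g \<Rightarrow> complex"
    and m :: nat
  assumes "kac_moody_algebra scale bracket A H coroot sroot e f"
    and "kac_moody_algebra.finite_or_affine scale bracket A"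
    and "I \<noteq> {}"
    and "\<beta> \<in> kac_moody_algebra.pos_roots scale bracket H sroot"
    and "kac_moody_algebra.ht sroot I \<beta> = of_nat m"
    and "m > 0"
  shows "\<exists>\<gamma> :: nat \<Rightarrow> 'g \<Rightarrow> complex.
           (\<forall>j\<in>{1..m}. \<gamma> j \<in> kac_moody_algebra.roots_ht_1 scale bracket H sroot I) \<and>
           \<beta> = (\<Sum>j=1..m. \<gamma> j) \<and>
           (\<forall>i\<in>{1..m}. (\<Sum>j=1..i. \<gamma> j) \<in> kac_moody_algebra.pos_roots scale bracket H sroot)"
proof -
  obtain k where "m = Suc k" using assms(6) not0_implies_Suc by blast
  then show ?thesis
    using kac_moody_algebra.pos_root_partial_sums[OF assms(1,4), of I k] assms(5) by simp
qed

end
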